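(* Let $G$ be a finite simple graph and let $d\ge 2$ be an integer. Then $G$ is (isomorphic to) the competition graph of a $d$-partial order if and only if there exist a family $\mathcal{F}$ of interiors of regular $(d-1)$-simplices in $\mathbb{R}^d$, each contained in the hyperplane $\mathcal{H}^d=\{\mathbf{x}\in\mathbb{R}^d \mid \sum_{i=1}^d x_i=0\}$ and homothetic to $A^{d-1}(\mathbf{1})=\{\mathbf{x}\in\mathcal{H}^d \mid \mathbf{x}\prec\mathbf{1}\}$, and a one-to-one correspondence between the vertex set of $G$ and $\mathcal{F}$ such that two vertices $v$ and $w$ are adjacent in $G$ if and only if the intersection of the two elements of $\mathcal{F}$ corresponding to $v$ and $w$ contains the closure of another element of $\mathcal{F}$.
   Context: For $\mathbf{x},\mathbf{y}\in\mathbb{R}^d$, write $\mathbf{x}\prec\mathbf{y}$ if $x_i<y_i$ for every $i=1,\dots,d$; $\mathbf{1}=(1,\dots,1)$. For a finite set $S\subseteq\mathbb{R}^d$, $D_S$ is the digraph with vertex set $S$ and an arc $(\mathbf{x},\mathbf{v})$ whenever $\mathbf{v},\mathbf{x}\in S$ and $\mathbf{v}\prec\mathbf{x}$. A digraph is a $d$-partial order if it is isomorphic to $D_S$ for some finite $S\subseteq\mathbb{R}^d$. The competition graph $C(D)$ of a digraph $D$ has vertex set $V(D)$ and an edge between distinct $x,y$ iff there is a vertex $z$ with arcs $(x,z)$ and $(y,z)$ in $D$. Two figures are homothetic if one is the image of the other under a map $\mathbf{x}\mapsto\lambda\mathbf{x}+\mathbf{b}$ with $\lambda>0$ (a contraction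 or expansion combined with a translation). *)

theory Defs
  imports
    "HOL-Analysis.Analysis"
    "Graph_Theory.Pair_Digraph"
    "Graph_Theory.Digraph_Isomorphism"
begin

text \<open>
  On \<open>real ^ 'd\<close> the relation \<open><\<close> is the strict part of the componentwise order \<open>\<le>\<close>.
  The relation \<open>x \<prec> y\<close>, strict in every coordinate, is instead the library constant
  \<^const>\<open>eucl_less\<close>.
\<close>

notation eucl_less (infix "\<prec>" 50)

lemma eucl_less_vec_iff:
  fixes x y :: "real ^ 'd"
  shows "x \<prec> y \<longleftrightarrow> (\<forall>i. x $ i < y $ i)"
  by (auto simp: eucl_less_def Basis_vec_def inner_axis)

definition dominance_digraph :: "(real ^ 'd) set \<Rightarrow> (real ^ 'd) pair_pre_digraph" where
  "dominance_digraph S = \<lparr> pverts = S, parcs = {(x, v). x \<in> S \<and> v \<in> S \<and> v \<prec> x} \<rparr>"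

text \<open>The dimension \<open>d\<close> is \<open>CARD('d)\<close>.\<close>

definition d_partial_order :: "'d::finite itself \<Rightarrow> 'a pair_pre_digraph \<Rightarrow> bool" where
  "d_partial_order _ D \<longleftrightarrow>
    (\<exists>S :: (real ^ 'd) set. finite S \<and>
       digraph_iso (with_proj D) (with_proj (dominance_digraph S)))"

text \<open>
  Undirected graphs are represented as symmetric loopless digraphs, as in the locale
  \<^locale>\<open>pair_graph\<close>.
\<close>

definition competition_graph :: "'a pair_pre_digraph \<Rightarrow> 'a pair_pre_digraph" where
  "competition_graph D =
    \<lparr> pverts = pverts D,
      parcs = {(x, y). x \<in> pverts D \<and> y \<in> pverts D \<and> x \<noteq> y \<and>
                (\<exists>z \<in> pverts D. (x, z) \<in> parcs D \<and> (y, z) \<in> parcs D)} \<rparr>"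

definition zero_sum_hyperplane :: "(real ^ 'd) set" where
  "zero_sum_hyperplane = {x. (\<Sum>i\<in>UNIV. x $ i) = 0}"

definition open_simplex_below :: "real ^ 'd \<Rightarrow> (real ^ 'd) set" where
  "open_simplex_below p = {x \<in> zero_sum_hyperplane. x \<prec> p}"

definition homothetic :: "'a::real_vector set \<Rightarrow> 'a set \<Rightarrow> bool" where
  "homothetic A B \<longleftrightarrow> (\<exists>c b. c > (0::real) \<and> B = (\<lambda>x. c *\<^sub>R x + b) ` A)"

text \<open>A simplex is regular if all its edges have the same length.\<close>

definition regular_simplex :: "int \<Rightarrow> 'a::euclidean_space set \<Rightarrow> bool" where
  "regular_simplex n T \<longleftrightarrow> n simplex T \<and>
    (\<exists>r. \<forall>x y. x extreme_point_of T \<and> y extreme_point_of T \<and> x \<noteq> y \<longrightarrow> dist x y = r)"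

end

theory Submission
  imports Defs
begin

text \<open>
  A point \<open>p\<close> with positive coordinate sum corresponds to the open simplex
  \<open>{x \<in> \<H>. x \<prec> p}\<close>, which has the vertices \<open>p - (\<Sum>\<^sub>j p\<^sub>j) e\<^sub>i\<close>.  Since \<open>d \<ge> 2\<close>, every coordinate
  \<open>p\<^sub>j\<close> is attained at a vertex, so the closed simplex of \<open>v\<close> lies in the open simplex of
  \<open>w\<close> iff \<open>v \<prec> w\<close>.  The open simplices of points with positive sum are exactly the subsets of the
  hyperplane homothetic to that of \<open>1\<close>, and a finite \<open>S\<close> can be translated along \<open>1\<close> to make all
  its coordinate sums positive without changing its digraph.
\<close>

no_notation lesspoll (infixl \<open>\<prec>\<close> 50)

section \<open>Barycentric description of the open simplices\<close>

definition coord_sum :: "real ^ 'd \<Rightarrow> real" where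
  "coord_sum p = (\<Sum>i\<in>UNIV. p $ i)"

definition simplex_vertex :: "real ^ 'd \<Rightarrow> 'd \<Rightarrow> real ^ 'd" where
  "simplex_vertex p i = p - coord_sum p *\<^sub>R axis i 1"

lemma simplex_vertex_nth:
  "simplex_vertex p i $ j = (if j = i then p $ j - coord_sum p else p $ j)"
  by (simp add: simplex_vertex_def axis_def)

lemma inj_simplex_vertex:
  assumes "coord_sum p \<noteq> 0"
  shows "inj (simplex_vertex p)"
  using assms by (auto simp: inj_def simplex_vertex_def axis_eq_axis)

text \<open>Each vertex differs from \<open>p\<close> in one coordinate only, so a weighted sum
  separates coordinatewise. Once the total weight is known, each weight can be read off from its own
  coordinate if \<open>coord_sum p\<close> is nonzero.\<close>

lemma sum_scaleR_simplex_vertex: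
  "(\<Sum>i\<in>UNIV. u i *\<^sub>R simplex_vertex p i) = (\<chi> j. sum u UNIV * p $ j - coord_sum p * u j)"
  by (simp add: vec_eq_iff simplex_vertex_def axis_def algebra_simps sum_subtractf
      sum_distrib_right sum_distrib_left if_distrib[of "\<lambda>x. _ * x"] cong: if_cong)

text \<open>Weights of total 0 cancel the contribution of \<open>p\<close>. A vanishing combination
  then has coordinates \<open>coord_sum p * u j = 0\<close>, which forces every weight to be
  0.\<close>

lemma affine_independent_simplex_vertices:
  assumes "coord_sum p \<noteq> 0"
  shows "\<not> affine_dependent (range (simplex_vertex p))"
proof
  assume "affine_dependent (range (simplex_vertex p))"
  then obtain U where U: "sum U (range (simplex_vertex p)) = 0"
      "\<exists>v\<in>range (simplex_vertex p). U v \<noteq> 0"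
      "(\<Sum>v\<in>range (simplex_vertex p). U v *\<^sub>R v) = 0"
    by (auto simp: affine_dependent_explicit_finite)
  \<comment> \<open>The weights are moved from the vertices to their indices, which injectivity
    permits, so that the coordinate formula applies.\<close>
  define u where "u = U \<circ> simplex_vertex p"
  have "sum u UNIV = 0" "(\<Sum>i\<in>UNIV. u i *\<^sub>R simplex_vertex p i) = 0"
    using U inj_simplex_vertex[OF assms] by (simp_all add: sum.reindex u_def)
  then have "coord_sum p * u j = 0" for j
    by (auto simp: sum_scaleR_simplex_vertex vec_eq_iff)
  then show False
    using U(2) assms by (auto simp: u_def)
qed

text \<open>The barycentric coordinates of a point \<open>y\<close> of the hyperplane are
  \<open>(p $ j - y $ j) / coord_sum p\<close>. They sum to 1 because \<open>y\<close> has
  coordinate sum 0, and they are all positive exactly when \<open>y \<prec> p\<close>.\<close>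

lemma rel_interior_simplex_vertices:
  assumes "coord_sum p > 0"
  shows "rel_interior (convex hull range (simplex_vertex p)) = open_simplex_below p"
proof -
  have inj: "inj (simplex_vertex p)"
    using assms by (intro inj_simplex_vertex) simp
  have "rel_interior (convex hull range (simplex_vertex p)) =
    {y. \<exists>u. (\<forall>x\<in>range (simplex_vertex p). 0 < u x) \<and> sum u (range (simplex_vertex p)) = 1
      \<and> (\<Sum>x\<in>range (simplex_vertex p). u x *\<^sub>R x) = y}"
    using assms
    by (intro rel_interior_convex_hull_explicit affine_independent_simplex_vertices) simp
  also have "\<dots> = open_simplex_below p"
  proof (intro set_eqI iffI)
    fix y
    assume "y \<in> {y. \<exists>u. (\<forall>x\<in>range (simplex_vertex p). 0 < u x)
      \<and> sum u (range (simplex_vertex p)) = 1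
      \<and> (\<Sum>x\<in>range (simplex_vertex p). u x *\<^sub>R x) = y}"
    then obtain U where U: "\<And>i. 0 < U (simplex_vertex p i)"
        "(\<Sum>i\<in>UNIV. U (simplex_vertex p i)) = 1"
        "y = (\<Sum>i\<in>UNIV. U (simplex_vertex p i) *\<^sub>R simplex_vertex p i)"
      using inj by (auto simp: sum.reindex)
    define u where "u i = U (simplex_vertex p i)" for i
    have y: "y = (\<chi> j. p $ j - coord_sum p * u j)"
      using U(2) by (simp add: U(3) sum_scaleR_simplex_vertex flip: u_def)
    have "(\<Sum>j\<in>UNIV. y $ j) = coord_sum p - coord_sum p * sum u UNIV"
      by (simp add: y sum_subtractf coord_sum_def flip: sum_distrib_left)
    then have "y \<in> zero_sum_hyperplane"
      using U(2) by (simp add: zero_sum_hyperplane_def flip: u_def)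
    moreover have "y \<prec> p"
      using U(1) assms by (simp add: eucl_less_vec_iff y u_def)
    ultimately show "y \<in> open_simplex_below p"
      by (simp add: open_simplex_below_def)
  next
    fix y
    assume "y \<in> open_simplex_below p"
    then have y: "(\<Sum>j\<in>UNIV. y $ j) = 0" "\<And>j. y $ j < p $ j"
      by (auto simp: open_simplex_below_def zero_sum_hyperplane_def eucl_less_vec_iff)
    \<comment> \<open>Obtained by solving \<open>y $ j = p $ j - coord_sum p * u j\<close>, the
      coordinate formula for total weight 1.\<close>
    define u where "u j = (p $ j - y $ j) / coord_sum p" for j
    \<comment> \<open>The explicit form of the relative interior wants weights on points, hence the
      passage back from indices to vertices.\<close>
    define U where "U = u \<circ> inv (simplex_vertex p)"
    have [simp]: "U (simplex_vertex p i) = u i" for i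
      using inj by (simp add: U_def)
    have "sum u UNIV = (\<Sum>j\<in>UNIV. p $ j - y $ j) / coord_sum p"
      by (simp add: u_def sum_divide_distrib)
    also have "\<dots> = 1"
      using y(1) assms by (simp add: sum_subtractf flip: coord_sum_def)
    finally have u1: "sum u UNIV = 1" .
    have "(\<Sum>i\<in>UNIV. u i *\<^sub>R simplex_vertex p i) = y"
      using assms by (simp add: sum_scaleR_simplex_vertex u1 vec_eq_iff) (simp add: u_def)
    moreover have "0 < u i" for i
      using y(2) assms by (simp add: u_def)
    ultimately show "y \<in> {y. \<exists>u. (\<forall>x\<in>range (simplex_vertex p). 0 < u x)
      \<and> sum u (range (simplex_vertex p)) = 1
      \<and> (\<Sum>x\<in>range (simplex_vertex p). u x *\<^sub>R x) = y}"
      using inj u1 by (auto simp: sum.reindex intro!: exI[of _ U])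
  qed
  finally show ?thesis .
qed

lemma dist_axis:
  fixes i j :: "'d::finite"
  assumes "i \<noteq> j"
  shows "dist (axis i (1::real)) (axis j 1) = sqrt 2"
  using assms by (simp add: dist_norm norm_eq_sqrt_inner inner_diff inner_axis_axis)

text \<open>Extreme points of the hull are among the listed vertices, and two of these differ by
  \<open>coord_sum p\<close> times a difference of unit vectors. All edges thus have length
  \<open>\<bar>coord_sum p\<bar> * sqrt 2\<close>.\<close>

lemma regular_simplex_simplex_vertices:
  fixes p :: "real ^ 'd"
  assumes "coord_sum p \<noteq> 0"
  shows "regular_simplex (int CARD('d) - 1) (convex hull range (simplex_vertex p))"
  unfolding regular_simplex_def
proof
  have "card (range (simplex_vertex p)) = CARD('d)"
    using inj_simplex_vertex[OF assms] by (simp add: card_image)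
  then show "int CARD('d) - 1 simplex convex hull range (simplex_vertex p)"
    unfolding simplex_def using affine_independent_simplex_vertices[OF assms]
    by (intro exI[of _ "range (simplex_vertex p)"]) simp
next
  have "dist x y = \<bar>coord_sum p\<bar> * sqrt 2"
    if xy: "x extreme_point_of convex hull range (simplex_vertex p)"
      "y extreme_point_of convex hull range (simplex_vertex p)" "x \<noteq> y" for x y
  proof -
    obtain i j where ij: "x = simplex_vertex p i" "y = simplex_vertex p j"
      using xy by (auto dest!: extreme_point_of_convex_hull)
    then have "i \<noteq> j"
      using xy by auto
    have "x - y = coord_sum p *\<^sub>R (axis j 1 - axis i 1)"
      by (simp add: ij simplex_vertex_def algebra_simps)
    then have "dist x y = \<bar>coord_sum p\<bar> * dist (axis j (1::real)) (axis i 1)"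
      by (simp add: dist_norm)
    then show ?thesis
      using \<open>i \<noteq> j\<close> by (simp add: dist_axis)
  qed
  then show "\<exists>r. \<forall>x y. x extreme_point_of convex hull range (simplex_vertex p) \<and>
      y extreme_point_of convex hull range (simplex_vertex p) \<and> x \<noteq> y \<longrightarrow> dist x y = r"
    by blast
qed

section \<open>Closures and inclusions of open simplices\<close>

text \<open>A convex set and its relative interior have the same closure, and the hull contains its
  vertices.\<close>

lemma simplex_vertex_in_closure:
  assumes "coord_sum p > 0"
  shows "simplex_vertex p i \<in> closure (open_simplex_below p)"
proof -
  have "simplex_vertex p i \<in> convex hull range (simplex_vertex p)"
    by (simp add: hull_inc)
  then show ?thesis
    using convex_closure_rel_interior[OF convex_convex_hull, of "range (simplex_vertex p)"]
      closure_subset rel_interior_simplex_vertices[OF assms] by fastforce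
qed

lemma closure_open_simplex_below_subset:
  "closure (open_simplex_below p) \<subseteq> {x \<in> zero_sum_hyperplane. x \<le> p}"
proof (rule closure_minimal)
  show "open_simplex_below p \<subseteq> {x \<in> zero_sum_hyperplane. x \<le> p}"
    by (auto simp: open_simplex_below_def eucl_less_vec_iff less_eq_vec_def less_imp_le)
  have "{x \<in> zero_sum_hyperplane. x \<le> p} =
      {x. (\<Sum>i\<in>UNIV. x $ i) = 0} \<inter> (\<Inter>i. {x. x $ i \<le> p $ i})"
    by (auto simp: zero_sum_hyperplane_def less_eq_vec_def)
  also have "closed \<dots>"
    by (intro closed_Int closed_INT ballI closed_Collect_eq closed_Collect_le continuous_intros)
  finally show "closed {x \<in> zero_sum_hyperplane. x \<le> p}" .
qed

text \<open>Vertex \<open>i\<close> alters coordinate \<open>i\<close> only, so any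
  \<open>i \<noteq> j\<close> serves. For \<open>d = 1\<close> there is no such index: every open
  simplex with positive coordinate sum is then \<open>{0}\<close>.\<close>

lemma coordinate_attained_at_vertex:
  assumes "CARD('d::finite) \<ge> 2"
  obtains i where "simplex_vertex p i $ j = (p :: real ^ 'd) $ j"
proof -
  have "\<exists>i::'d. i \<noteq> j"
  proof (rule ccontr)
    assume "\<not> (\<exists>i::'d. i \<noteq> j)"
    then have "(UNIV :: 'd set) = {j}"
      by auto
    then have "CARD('d) = 1"
      by (metis card_1_singleton_iff One_nat_def)
    with assms show False
      by simp
  qed
  then obtain i where "i \<noteq> j" ..
  then show thesis
    by (intro that[of i]) (simp add: simplex_vertex_nth)
qed

text \<open>Forwards, a vertex in the closure that attains \<open>v $ j\<close> must lie strictly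
  below \<open>w\<close>. Backwards, all points of the closure are \<open>\<le> v\<close>, hence
  \<open>\<prec> w\<close>.\<close>

lemma closure_open_simplex_below_subset_iff:
  fixes v w :: "real ^ 'd"
  assumes d: "CARD('d) \<ge> 2" and v: "coord_sum v > 0"
  shows "closure (open_simplex_below v) \<subseteq> open_simplex_below w \<longleftrightarrow> v \<prec> w"
proof
  assume sub: "closure (open_simplex_below v) \<subseteq> open_simplex_below w"
  have "v $ j < w $ j" for j
  proof -
    obtain i where i: "simplex_vertex v i $ j = v $ j"
      using d by (rule coordinate_attained_at_vertex)
    have "simplex_vertex v i \<in> open_simplex_below w"
      using simplex_vertex_in_closure[OF v] sub by blast
    then show ?thesis
      unfolding open_simplex_below_def eucl_less_vec_iff using i
      by (metis (no_types, lifting) mem_Collect_eq)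
  qed
  then show "v \<prec> w"
    by (simp add: eucl_less_vec_iff)
next
  assume "v \<prec> w"
  then have "x \<prec> w" if "x \<le> v" for x
    using that unfolding eucl_less_vec_iff less_eq_vec_def by (meson le_less_trans)
  then show "closure (open_simplex_below v) \<subseteq> open_simplex_below w"
    using closure_open_simplex_below_subset[of v] by (auto simp: open_simplex_below_def)
qed

text \<open>The vertex argument again, now after taking closures on both sides. Applied in both
  directions it recovers a point from its open simplex by antisymmetry.\<close>

lemma open_simplex_below_subset_imp_le:
  fixes v w :: "real ^ 'd"
  assumes d: "CARD('d) \<ge> 2" and v: "coord_sum v > 0"
    and sub: "open_simplex_below v \<subseteq> open_simplex_below w"
  shows "v \<le> w"
proof -
  have "v $ j \<le> w $ j" for j
  proof -
    obtain i where i: "simplex_vertex v i $ j = v $ j"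
      using d by (rule coordinate_attained_at_vertex)
    have "simplex_vertex v i \<le> w"
      using simplex_vertex_in_closure[OF v] closure_mono[OF sub]
        closure_open_simplex_below_subset[of w] by blast
    then show ?thesis
      using i by (metis less_eq_vec_def)
  qed
  then show ?thesis
    by (simp add: less_eq_vec_def)
qed

lemma inj_on_open_simplex_below:
  assumes "CARD('d) \<ge> 2"
  shows "inj_on open_simplex_below {p :: real ^ 'd. coord_sum p > 0}"
proof (rule inj_onI)
  fix v w :: "real ^ 'd"
  assume "v \<in> {p. coord_sum p > 0}" "w \<in> {p. coord_sum p > 0}"
    and "open_simplex_below v = open_simplex_below w"
  then show "v = w"
    using open_simplex_below_subset_imp_le[OF assms, of v w]
      open_simplex_below_subset_imp_le[OF assms, of w v] by (simp add: order.antisym)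
qed

section \<open>Homothetic copies of the standard open simplex\<close>

lemma coord_sum_algebra:
  "coord_sum (x + y) = coord_sum x + coord_sum y"
  "coord_sum (x - y) = coord_sum x - coord_sum y"
  "coord_sum (c *\<^sub>R x) = c * coord_sum x"
  "coord_sum (1 :: real ^ 'd) = CARD('d)"
  by (simp_all add: coord_sum_def sum.distrib sum_subtractf sum_distrib_left)

lemma open_simplex_below_alt: "open_simplex_below p = {x. coord_sum x = 0 \<and> x \<prec> p}"
  by (simp add: open_simplex_below_def zero_sum_hyperplane_def coord_sum_def)

text \<open>The scaling that turns the coordinate sum of \<open>p\<close> into \<open>d\<close>,
  followed by the translation that then carries \<open>p\<close> to \<open>1\<close>, preserves the
  hyperplane because \<open>b\<close> has coordinate sum 0. It also preserves
  \<open>\<prec>\<close>.\<close>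

lemma homothetic_open_simplex_below_one:
  fixes p :: "real ^ 'd"
  assumes "coord_sum p > 0"
  shows "homothetic (open_simplex_below p) (open_simplex_below 1)"
proof -
  define s where "s = coord_sum p / CARD('d)"
  have s: "s > 0" "coord_sum p = s * CARD('d)"
    using assms by (simp_all add: s_def)
  define c where "c = 1 / s"
  define b where "b = 1 - c *\<^sub>R p"
  have "open_simplex_below 1 = (\<lambda>x. c *\<^sub>R x + b) ` open_simplex_below p"
  proof (intro set_eqI iffI)
    fix y :: "real ^ 'd"
    assume y: "y \<in> open_simplex_below 1"
    \<comment> \<open>The preimage of \<open>y\<close>, from solving
      \<open>y = c *\<^sub>R x + b\<close> for \<open>x\<close>.\<close>
    define x where "x = p + s *\<^sub>R (y - 1)"
    have "x \<in> open_simplex_below p"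
      using y s by (auto simp: open_simplex_below_alt x_def coord_sum_algebra eucl_less_vec_iff
          mult_pos_neg right_diff_distrib)
    moreover have "y = c *\<^sub>R x + b"
      using s by (simp add: x_def b_def c_def algebra_simps)
    ultimately show "y \<in> (\<lambda>x. c *\<^sub>R x + b) ` open_simplex_below p"
      by blast
  next
    fix y
    assume "y \<in> (\<lambda>x. c *\<^sub>R x + b) ` open_simplex_below p"
    then show "y \<in> open_simplex_below 1"
      using s by (auto simp: open_simplex_below_alt b_def c_def coord_sum_algebra eucl_less_vec_iff
          divide_strict_right_mono)
  qed
  moreover have "c > 0"
    using s by (simp add: c_def)
  ultimately show ?thesis
    unfolding homothetic_def by blast
qed

text \<open>The point sought is the preimage of \<open>1\<close> under the homothety. Its coordinate
  sum is positive once the translation part \<open>b\<close> is known to lie in the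
  hyperplane.\<close>

lemma homothetic_open_simplex_below_oneD:
  fixes A :: "(real ^ 'd) set"
  assumes "homothetic A (open_simplex_below 1)" and A: "A \<subseteq> zero_sum_hyperplane"
  obtains p where "coord_sum p > 0" "A = open_simplex_below p"
proof -
  obtain c b where c: "c > 0" and eq: "open_simplex_below 1 = (\<lambda>x. c *\<^sub>R x + b) ` A"
    using assms by (auto simp: homothetic_def)
  have A0: "coord_sum x = 0" if "x \<in> A" for x
    using A that by (auto simp: zero_sum_hyperplane_def coord_sum_def)
  \<comment> \<open>Any point of the image would do to compare coordinate sums. With 0 the vector
    \<open>b\<close> becomes a multiple of a point \<open>z\<close> of \<open>A\<close>, so its sum
    is 0.\<close>
  have "(0 :: real ^ 'd) \<in> open_simplex_below 1"
    by (simp add: open_simplex_below_alt eucl_less_vec_iff coord_sum_def)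
  then obtain z where "z \<in> A" "0 = c *\<^sub>R z + b"
    using eq by auto
  then have b: "coord_sum b = 0"
    using A0[of z] coord_sum_algebra(1)[of "c *\<^sub>R z" b] coord_sum_algebra(3)[of c z]
    by (simp add: coord_sum_def)
  define p where "p = (1 / c) *\<^sub>R (1 - b)"
  have "coord_sum p > 0"
    using c b by (simp add: p_def coord_sum_algebra)
  moreover have "A = open_simplex_below p"
  proof -
    have less_iff: "c *\<^sub>R x + b \<prec> 1 \<longleftrightarrow> x \<prec> p" for x
      using c by (simp add: eucl_less_vec_iff p_def field_simps)
    have "x \<in> A \<longleftrightarrow> c *\<^sub>R x + b \<in> open_simplex_below 1" for x
      using c by (auto simp: eq)
    also have "\<dots> x \<longleftrightarrow> x \<in> open_simplex_below p" for x
      using b c by (simp add: open_simplex_below_alt less_iff coord_sum_algebra)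
    finally show ?thesis
      by blast
  qed
  ultimately show thesis ..
qed

section \<open>Isomorphisms of pair digraphs as vertex bijections\<close>

text \<open>Arcs are pairs with tail \<open>fst\<close> and head \<open>snd\<close>, so
  compatibility with tails and heads forces the arc map to be \<open>map_prod f f\<close> on the
  arcs.\<close>

lemma digraph_iso_with_proj_iff:
  "digraph_iso (with_proj G) (with_proj H) \<longleftrightarrow>
    pair_wf_digraph G \<and>
    (\<exists>f. bij_betw f (pverts G) (pverts H) \<and> parcs H = map_prod f f ` parcs G)"
proof
  assume "digraph_iso (with_proj G) (with_proj H)"
  then obtain h where h: "pre_digraph.digraph_isomorphism (with_proj G) h"
      "with_proj H = app_iso h (with_proj G)"
    by (auto simp: digraph_iso_def)
  then have eqs: "pverts H = iso_verts h ` pverts G" "parcs H = iso_arcs h ` parcs G"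
      "iso_tail h = fst" "iso_head h = snd"
    by (simp_all add: with_proj_def app_iso_def)
  have iso: "pair_wf_digraph G" "inj_on (iso_verts h) (pverts G)"
      "\<And>a. a \<in> parcs G \<Longrightarrow> iso_verts h (fst a) = fst (iso_arcs h a)
        \<and> iso_verts h (snd a) = snd (iso_arcs h a)"
    using h(1) eqs(3,4) by (auto simp: pre_digraph.digraph_isomorphism_def wf_digraph_wp_iff)
  have "iso_arcs h a = map_prod (iso_verts h) (iso_verts h) a" if "a \<in> parcs G" for a
    using iso(3)[OF that] by (simp add: prod_eq_iff)
  then have "parcs H = map_prod (iso_verts h) (iso_verts h) ` parcs G"
    unfolding eqs by (rule image_cong[OF refl])
  then show "pair_wf_digraph G \<and>
    (\<exists>f. bij_betw f (pverts G) (pverts H) \<and> parcs H = map_prod f f ` parcs G)"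
    using iso(1,2) eqs(1) by (auto simp: bij_betw_def)
next
  assume "pair_wf_digraph G \<and>
    (\<exists>f. bij_betw f (pverts G) (pverts H) \<and> parcs H = map_prod f f ` parcs G)"
  then obtain f where wf: "pair_wf_digraph G" and f: "bij_betw f (pverts G) (pverts H)"
      and arcs: "parcs H = map_prod f f ` parcs G"
    by blast
  define h where "h = \<lparr>iso_verts = f, iso_arcs = map_prod f f, iso_head = snd, iso_tail = fst\<rparr>"
  have sub: "parcs G \<subseteq> pverts G \<times> pverts G"
    using wf by (auto simp: pair_wf_digraph_def)
  have "inj_on (map_prod f f) (parcs G)"
    using f by (intro inj_on_subset[OF map_prod_inj_on sub]) (auto simp: bij_betw_def)
  then have "pre_digraph.digraph_isomorphism (with_proj G) h"
    using f wf
    by (auto simp: pre_digraph.digraph_isomorphism_def h_def bij_betw_def wf_digraph_wp_iff)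
  moreover have "with_proj H = app_iso h (with_proj G)"
    using f arcs by (simp add: with_proj_def app_iso_def h_def bij_betw_def)
  ultimately show "digraph_iso (with_proj G) (with_proj H)"
    by (auto simp: digraph_iso_def)
qed

text \<open>Well-formedness of \<open>H\<close> puts both ends of each of its arcs in the image of
  \<open>f\<close>. Equality of arc sets can therefore be tested on pairs of vertices of
  \<open>G\<close>.\<close>

lemma digraph_iso_with_proj_iff':
  assumes G: "pair_wf_digraph G" and H: "pair_wf_digraph H"
  shows "digraph_iso (with_proj G) (with_proj H) \<longleftrightarrow>
    (\<exists>f. bij_betw f (pverts G) (pverts H) \<and>
      (\<forall>u\<in>pverts G. \<forall>v\<in>pverts G. (u, v) \<in> parcs G \<longleftrightarrow> (f u, f v) \<in> parcs H))"
proof -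
  have subG: "parcs G \<subseteq> pverts G \<times> pverts G" and subH: "parcs H \<subseteq> pverts H \<times> pverts H"
    using G H by (auto simp: pair_wf_digraph_def)
  have "parcs H = map_prod f f ` parcs G \<longleftrightarrow>
      (\<forall>u\<in>pverts G. \<forall>v\<in>pverts G. (u, v) \<in> parcs G \<longleftrightarrow> (f u, f v) \<in> parcs H)"
    if f: "bij_betw f (pverts G) (pverts H)" for f
  proof
    assume eq: "parcs H = map_prod f f ` parcs G"
    have "(u, v) \<in> parcs G \<longleftrightarrow> (f u, f v) \<in> parcs H" if "u \<in> pverts G" "v \<in> pverts G" for u v
    proof
      assume "(f u, f v) \<in> parcs H"
      then obtain u' v' where "(u', v') \<in> parcs G" "f u = f u'" "f v = f v'"
        by (auto simp: eq)
      \<comment> \<open>Well-formedness of \<open>G\<close> makes \<open>u'\<close> and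
        \<open>v'\<close> vertices, where \<open>f\<close> is injective.\<close>
      moreover from this have "u' = u" "v' = v"
        using subG that f by (auto simp: bij_betw_def dest: inj_onD)
      ultimately show "(u, v) \<in> parcs G"
        by simp
    qed (auto simp: eq)
    then show "\<forall>u\<in>pverts G. \<forall>v\<in>pverts G. (u, v) \<in> parcs G \<longleftrightarrow> (f u, f v) \<in> parcs H"
      by blast
  next
    assume iff: "\<forall>u\<in>pverts G. \<forall>v\<in>pverts G. (u, v) \<in> parcs G \<longleftrightarrow> (f u, f v) \<in> parcs H"
    show "parcs H = map_prod f f ` parcs G"
    proof (intro equalityI subsetI)
      fix e assume e: "e \<in> parcs H"
      then obtain u v where uv: "e = (f u, f v)" "u \<in> pverts G" "v \<in> pverts G"
        using subH bij_betw_imp_surj_on[OF f] by blast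
      then have "(u, v) \<in> parcs G"
        using iff e by blast
      then show "e \<in> map_prod f f ` parcs G"
        using uv by force
    qed (use iff subG in auto)
  qed
  then show ?thesis
    using G by (simp add: digraph_iso_with_proj_iff cong: conj_cong)
qed

section \<open>Competition graphs expressed by points of Euclidean space\<close>

lemma pair_wf_digraph_dominance_digraph: "pair_wf_digraph (dominance_digraph S)"
  by (auto simp: pair_wf_digraph_def dominance_digraph_def)

lemma pair_wf_digraph_competition_graph: "pair_wf_digraph (competition_graph D)"
  by (auto simp: pair_wf_digraph_def competition_graph_def)

text \<open>Composing the isomorphisms from \<open>G\<close> and to the dominance digraph places the
  vertices of \<open>G\<close> at points. Arcs go to the smaller point, so a common out-neighbour is
  a common strict lower bound among these points.\<close>

lemma competition_graph_d_partial_order_iff: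
  fixes G :: "'a pair_pre_digraph"
  assumes "pair_graph G"
  shows "(\<exists>D :: (real ^ 'd) pair_pre_digraph.
        d_partial_order TYPE('d) D \<and>
        digraph_iso (with_proj G) (with_proj (competition_graph D))) \<longleftrightarrow>
    (\<exists>f :: 'a \<Rightarrow> real ^ 'd. inj_on f (pverts G) \<and>
      (\<forall>v\<in>pverts G. \<forall>w\<in>pverts G. v \<noteq> w \<longrightarrow>
        ((v, w) \<in> parcs G \<longleftrightarrow> (\<exists>z\<in>pverts G. f z \<prec> f v \<and> f z \<prec> f w))))"
    (is "?L \<longleftrightarrow> (\<exists>f. inj_on f _ \<and> ?P f)")
proof (intro iffI)
  interpret pair_graph G by fact
  have wf: "pair_wf_digraph G" ..
  assume ?L
  then obtain D :: "(real ^ 'd) pair_pre_digraph" and S :: "(real ^ 'd) set"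
    where isoS: "digraph_iso (with_proj D) (with_proj (dominance_digraph S))"
      and isoG: "digraph_iso (with_proj G) (with_proj (competition_graph D))"
    by (auto simp: d_partial_order_def)
  \<comment> \<open>Isomorphism to a dominance digraph includes well-formedness of \<open>D\<close>,
    which the adjacency form of isomorphism asks for.\<close>
  have "pair_wf_digraph D"
    using isoS by (simp add: digraph_iso_with_proj_iff)
  then obtain g where g: "bij_betw g (pverts D) S"
      and arcsD: "\<And>u v. u \<in> pverts D \<Longrightarrow> v \<in> pverts D \<Longrightarrow> (u, v) \<in> parcs D \<longleftrightarrow> g v \<prec> g u"
    using isoS unfolding digraph_iso_with_proj_iff'[OF \<open>pair_wf_digraph D\<close> pair_wf_digraph_dominance_digraph]
    by (auto simp: dominance_digraph_def bij_betw_def)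
  obtain h where h: "bij_betw h (pverts G) (pverts D)"
      and arcsG: "\<And>u v. u \<in> pverts G \<Longrightarrow> v \<in> pverts G \<Longrightarrow>
        (u, v) \<in> parcs G \<longleftrightarrow> (h u, h v) \<in> parcs (competition_graph D)"
    using isoG unfolding digraph_iso_with_proj_iff'[OF wf pair_wf_digraph_competition_graph]
    by (auto simp: competition_graph_def)
  have hD: "h v \<in> pverts D" if "v \<in> pverts G" for v
    using h that by (auto simp: bij_betw_def)
  have "inj_on (g \<circ> h) (pverts G)"
    using g h by (auto simp: bij_betw_def intro: comp_inj_on)
  moreover have "?P (g \<circ> h)"
  proof (intro ballI impI)
    fix v w assume vw: "v \<in> pverts G" "w \<in> pverts G" "v \<noteq> w"
    then have "h v \<noteq> h w"
      using h by (auto simp: bij_betw_def dest: inj_onD)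
    then have "(v, w) \<in> parcs G \<longleftrightarrow> (\<exists>z\<in>pverts D. g z \<prec> g (h v) \<and> g z \<prec> g (h w))"
      using vw hD by (auto simp: arcsG competition_graph_def arcsD)
    \<comment> \<open>Since \<open>h\<close> is onto \<open>pverts D\<close>, the common lower bound
      can be indexed by a vertex of \<open>G\<close>.\<close>
    also have "\<dots> \<longleftrightarrow> (\<exists>z\<in>pverts G. g (h z) \<prec> g (h v) \<and> g (h z) \<prec> g (h w))"
      by (simp flip: bij_betw_imp_surj_on[OF h])
    finally show "(v, w) \<in> parcs G \<longleftrightarrow>
        (\<exists>z\<in>pverts G. (g \<circ> h) z \<prec> (g \<circ> h) v \<and> (g \<circ> h) z \<prec> (g \<circ> h) w)"
      by simp
  qed
  ultimately show "\<exists>f. inj_on f (pverts G) \<and> ?P f"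
    by blast
next
  interpret pair_graph G by fact
  have wf: "pair_wf_digraph G" ..
  assume "\<exists>f. inj_on f (pverts G) \<and> ?P f"
  then obtain f where f: "inj_on f (pverts G)" and P: "?P f"
    by blast
  define D where "D = dominance_digraph (f ` pverts G)"
  have "digraph_iso (with_proj D) (with_proj D)"
    unfolding digraph_iso_with_proj_iff D_def
    using pair_wf_digraph_dominance_digraph by (auto simp: map_prod.id intro!: exI[of _ id])
  moreover have "finite (pverts G)"
    by simp
  ultimately have "d_partial_order TYPE('d) D"
    unfolding d_partial_order_def D_def using \<open>finite (pverts G)\<close>
    by (intro exI[of _ "f ` pverts G"]) simp
  moreover have "bij_betw f (pverts G) (pverts (competition_graph D))"
    using f by (auto simp: D_def bij_betw_def competition_graph_def dominance_digraph_def)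
  moreover have "(v, w) \<in> parcs G \<longleftrightarrow> (f v, f w) \<in> parcs (competition_graph D)"
    if vw: "v \<in> pverts G" "w \<in> pverts G" for v w
  \<comment> \<open>The hypothesis on \<open>f\<close> concerns distinct vertices only; on the
    diagonal both graphs are loopless.\<close>
  proof (cases "v = w")
    case True
    then show ?thesis
      by (auto simp: competition_graph_def dest: no_loops)
  next
    case False
    then have "f v \<noteq> f w"
      using f vw by (auto dest: inj_onD)
    then have "(f v, f w) \<in> parcs (competition_graph D) \<longleftrightarrow>
        (\<exists>z\<in>pverts G. f z \<prec> f v \<and> f z \<prec> f w)"
      using vw by (simp add: competition_graph_def D_def dominance_digraph_def cong: bex_cong)
    then show ?thesis
      using P vw False by blast
  qed
  ultimately show ?L
    by (intro exI[of _ D] conjI)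
      (auto simp: digraph_iso_with_proj_iff'[OF wf pair_wf_digraph_competition_graph])
qed

section \<open>Transfer between placements of vertices and families of simplices\<close>

theorem theorem2p9:
  fixes G :: "'a pair_pre_digraph"
  assumes "pair_graph G"
    and "CARD('d::finite) \<ge> 2"
  shows
    "(\<exists>D :: (real ^ 'd) pair_pre_digraph.
        d_partial_order TYPE('d) D \<and>
        digraph_iso (with_proj G) (with_proj (competition_graph D)))
     \<longleftrightarrow>
     (\<exists>(\<F> :: (real ^ 'd) set set) \<phi>.
        (\<forall>A \<in> \<F>.
           (\<exists>T. regular_simplex (int CARD('d) - 1) T \<and> A = rel_interior T) \<and>
           A \<subseteq> zero_sum_hyperplane \<and>
           homothetic A (open_simplex_below 1)) \<and>
        bij_betw \<phi> (pverts G) \<F> \<and>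
        (\<forall>v \<in> pverts G. \<forall>w \<in> pverts G. v \<noteq> w \<longrightarrow>
           ((v, w) \<in> parcs G \<longleftrightarrow>
            (\<exists>C \<in> \<F>. C \<noteq> \<phi> v \<and> C \<noteq> \<phi> w \<and> closure C \<subseteq> \<phi> v \<inter> \<phi> w))))"
    (is "?L \<longleftrightarrow> (\<exists>\<F> \<phi>. ?R \<F> \<phi>)")
proof -
  \<comment> \<open>This equivalence turns one adjacency condition into the other and serves both
    directions.\<close>
  have closure_iff: "(\<exists>C\<in>(\<lambda>v. open_simplex_below (p v)) ` pverts G.
        C \<noteq> open_simplex_below (p v) \<and> C \<noteq> open_simplex_below (p w) \<and>
        closure C \<subseteq> open_simplex_below (p v) \<inter> open_simplex_below (p w))
      \<longleftrightarrow> (\<exists>z\<in>pverts G. p z \<prec> p v \<and> p z \<prec> p w)"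
    if pos: "\<forall>v\<in>pverts G. coord_sum (p v) > 0" and vw: "v \<in> pverts G" "w \<in> pverts G"
    for p :: "'a \<Rightarrow> real ^ 'd" and v w
  proof -
    \<comment> \<open>A strict lower bound is a different point and so has a different simplex. The
      demand that \<open>C\<close> be another element thus holds by itself.\<close>
    have neq: "open_simplex_below x \<noteq> open_simplex_below y"
      if "x \<prec> y" "coord_sum x > 0" "coord_sum y > 0" for x y :: "real ^ 'd"
      using inj_onD[OF inj_on_open_simplex_below[OF assms(2)], of x y] that
      by (auto simp: eucl_less_vec_iff)
    have "closure (open_simplex_below (p z)) \<subseteq> open_simplex_below (p x) \<longleftrightarrow> p z \<prec> p x"
      if "z \<in> pverts G" for z x
      using closure_open_simplex_below_subset_iff[OF assms(2)] pos that by blast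
    then show ?thesis
      using neq pos vw by (simp cong: bex_cong conj_cong) metis
  qed
  show ?thesis
    unfolding competition_graph_d_partial_order_iff[OF assms(1)]
  proof (intro iffI; elim exE conjE)
    fix f :: "'a \<Rightarrow> real ^ 'd"
    assume f: "inj_on f (pverts G)"
      and P: "\<forall>v\<in>pverts G. \<forall>w\<in>pverts G. v \<noteq> w \<longrightarrow>
        ((v, w) \<in> parcs G \<longleftrightarrow> (\<exists>z\<in>pverts G. f z \<prec> f v \<and> f z \<prec> f w))"
    have "finite (pverts G)"
      using assms(1) by (simp add: pair_graph_def pair_digraph_def pair_fin_digraph_def
          pair_fin_digraph_axioms_def)
    \<comment> \<open>\<open>K\<close> strictly exceeds every
      \<open>\<bar>coord_sum (f v)\<bar>\<close>, thanks to the added 1. The shift by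
      \<open>K *\<^sub>R 1\<close> raises each coordinate sum by
      \<open>K * CARD('d) \<ge> K\<close>, and a common shift leaves \<open>\<prec>\<close>
      unchanged.\<close>
    define K where "K = (\<Sum>v\<in>pverts G. \<bar>coord_sum (f v)\<bar>) + 1"
    define p where "p v = f v + K *\<^sub>R 1" for v
    have pos: "\<forall>v\<in>pverts G. coord_sum (p v) > 0"
    proof
      fix v assume "v \<in> pverts G"
      then have "\<bar>coord_sum (f v)\<bar> < K"
        using member_le_sum[of v "pverts G" "\<lambda>v. \<bar>coord_sum (f v)\<bar>"] \<open>finite (pverts G)\<close>
        by (simp add: K_def)
      moreover from this have "K \<le> K * CARD('d)"
        using assms(2) by (simp add: mult_le_cancel_left1)
      ultimately show "coord_sum (p v) > 0"
        by (simp add: p_def coord_sum_algebra)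
    qed
    have p_less: "p v \<prec> p w \<longleftrightarrow> f v \<prec> f w" for v w
      by (simp add: p_def eucl_less_vec_iff)
    define \<phi> where "\<phi> v = open_simplex_below (p v)" for v
    have "inj_on p (pverts G)"
      using f by (simp add: inj_on_def p_def)
    then have "inj_on \<phi> (pverts G)"
      unfolding \<phi>_def using pos inj_on_open_simplex_below[OF assms(2)]
      by (auto simp: inj_on_def)
    \<comment> \<open>The witness \<open>T\<close> is the convex hull of the vertices
      \<open>simplex_vertex (p v) i\<close>.\<close>
    moreover have "(\<exists>T. regular_simplex (int CARD('d) - 1) T \<and> \<phi> v = rel_interior T) \<and>
        \<phi> v \<subseteq> zero_sum_hyperplane \<and> homothetic (\<phi> v) (open_simplex_below 1)"
      if "v \<in> pverts G" for v
    proof -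
      have "coord_sum (p v) > 0"
        using pos that by blast
      then show ?thesis
        using regular_simplex_simplex_vertices[of "p v"] rel_interior_simplex_vertices[of "p v"]
          homothetic_open_simplex_below_one[of "p v"]
        by (auto simp: \<phi>_def open_simplex_below_def)
    qed
    moreover have "(v, w) \<in> parcs G \<longleftrightarrow>
        (\<exists>C\<in>\<phi> ` pverts G. C \<noteq> \<phi> v \<and> C \<noteq> \<phi> w \<and> closure C \<subseteq> \<phi> v \<inter> \<phi> w)"
      if "v \<in> pverts G" "w \<in> pverts G" "v \<noteq> w" for v w
      unfolding \<phi>_def closure_iff[OF pos that(1,2)] p_less using P that by blast
    ultimately have "?R (\<phi> ` pverts G) \<phi>"
      by (simp add: bij_betw_def)
    then show "\<exists>\<F> \<phi>. ?R \<F> \<phi>"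
      by (intro exI)
  next
    fix \<F> :: "(real ^ 'd) set set" and \<phi>
    assume hom: "\<forall>A\<in>\<F>. (\<exists>T. regular_simplex (int CARD('d) - 1) T \<and> A = rel_interior T) \<and>
           A \<subseteq> zero_sum_hyperplane \<and> homothetic A (open_simplex_below 1)"
      and \<phi>: "bij_betw \<phi> (pverts G) \<F>"
      and adj: "\<forall>v \<in> pverts G. \<forall>w \<in> pverts G. v \<noteq> w \<longrightarrow>
           ((v, w) \<in> parcs G \<longleftrightarrow>
            (\<exists>C \<in> \<F>. C \<noteq> \<phi> v \<and> C \<noteq> \<phi> w \<and> closure C \<subseteq> \<phi> v \<inter> \<phi> w))"
    \<comment> \<open>Each simplex of the family yields its defining point; choosing one for every
      vertex of \<open>G\<close> gives the placement \<open>p\<close>.\<close>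
    have "\<exists>q. coord_sum q > 0 \<and> \<phi> v = open_simplex_below q" if "v \<in> pverts G" for v
    proof -
      have "\<phi> v \<in> \<F>"
        using \<phi> that by (auto simp: bij_betw_def)
      then show ?thesis
        using hom homothetic_open_simplex_below_oneD[of "\<phi> v"] by metis
    qed
    then obtain p where pos: "\<forall>v\<in>pverts G. coord_sum (p v) > 0"
        and p: "\<And>v. v \<in> pverts G \<Longrightarrow> \<phi> v = open_simplex_below (p v)"
      by metis
    have \<F>: "\<F> = (\<lambda>v. open_simplex_below (p v)) ` pverts G"
      using bij_betw_imp_surj_on[OF \<phi>] p by (metis (no_types, lifting) image_cong)
    \<comment> \<open>Equal points would give equal simplices, against the injectivity of
      \<open>\<phi>\<close>.\<close>
    have "inj_on p (pverts G)"
      using bij_betw_imp_inj_on[OF \<phi>] p by (auto simp: inj_on_def)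
    moreover have "(v, w) \<in> parcs G \<longleftrightarrow> (\<exists>z\<in>pverts G. p z \<prec> p v \<and> p z \<prec> p w)"
      if "v \<in> pverts G" "w \<in> pverts G" "v \<noteq> w" for v w
      using adj[rule_format, OF that] unfolding p[OF that(1)] p[OF that(2)] \<F>
        closure_iff[OF pos that(1,2)] .
    ultimately show "\<exists>f :: 'a \<Rightarrow> real ^ 'd. inj_on f (pverts G) \<and>
        (\<forall>v\<in>pverts G. \<forall>w\<in>pverts G. v \<noteq> w \<longrightarrow>
          ((v, w) \<in> parcs G \<longleftrightarrow> (\<exists>z\<in>pverts G. f z \<prec> f v \<and> f z \<prec> f w)))"
      by blast
  qed
qed

end
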